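(* Let $T$ be a rooted homogeneous tree of order $\gamma$ and let $B$ be the backward shift on $\mathcal{L}_0$. Then $\|B\|=2$ if $\gamma=1$, and $\|B\|=3\gamma-2$ if $\gamma\ge 2$.
   Context: A tree is an undirected graph (no loops or multiple edges) in which any two vertices are joined by exactly one path; $T$ also denotes its vertex set, which is assumed countably infinite, and every vertex has finite degree. $T$ has a distinguished vertex $o$, the root; $|v|$ is the length (number of edges) of the path from $o$ to $v$. For $v\neq o$, the parent $\mathrm{par}(v)$ is the vertex preceding $v$ on the unique path from $o$ to $v$; $\mathrm{Chi}(v)$ is the set of children of $v$ (vertices with parent $v$), and $\gamma(v)$ is its cardinality. $T$ is homogeneous of order $\gamma$ if $\gamma(v)=\gamma$ for all $v\in T$ (so $\gamma\geq 1$). For $f:T\to\mathbb{C}$ define $f'(o)=f(o)$ and $f'(v)=f(v)-f(\mathrm{par}(v))$ for $v\neq o$. The little Lipschitz space $\mathcal{L}_0$ is the Banach space of all $f:T\to\mathbb{C}$ with $\lim_{|v|\to\infty}f'(v)=0$, with norm $\|f\|=\sup_{v\in T}|f'(v)|$. The backward shift is $(Bf)(v)=\sum_{w\in\mathrm{Chi}(v)}f(w)$. *)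

theory Defs
  imports
    "HOL-Analysis.Analysis"
    "Graph_Theory.Pair_Digraph"
    "Graph_Theory.Vertex_Walk"
begin

text \<open>
  An undirected simple graph is a symmetric loop-free digraph whose arcs are pairs of vertices.
  A path is a list of pairwise distinct vertices, consecutive ones being adjacent; the path from
  \<open>u\<close> to \<open>u\<close> is \<open>[u]\<close>.
\<close>

definition path_between :: "'a pair_pre_digraph \<Rightarrow> 'a \<Rightarrow> 'a \<Rightarrow> 'a list \<Rightarrow> bool" where
  "path_between T u v p \<longleftrightarrow> vpath p (with_proj T) \<and> hd p = u \<and> last p = v"

locale rooted_tree = pair_bidirected_digraph T for T :: "'a pair_pre_digraph" +
  fixes root :: 'a
  assumes root_in_verts: "root \<in> pverts T"
    and unique_path: "\<lbrakk>u \<in> pverts T; v \<in> pverts T\<rbrakk> \<Longrightarrow> \<exists>!p. path_between T u v p"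
    and countable_verts: "countable (pverts T)"
    and infinite_verts: "infinite (pverts T)"
    and finite_degree: "v \<in> pverts T \<Longrightarrow> finite {w. (v, w) \<in> parcs T}"

definition tree_path :: "'a pair_pre_digraph \<Rightarrow> 'a \<Rightarrow> 'a \<Rightarrow> 'a list" where
  "tree_path T u v = (THE p. path_between T u v p)"

definition depth :: "'a pair_pre_digraph \<Rightarrow> 'a \<Rightarrow> 'a \<Rightarrow> nat" where
  "depth T r v = vwalk_length (tree_path T r v)"

text \<open>Only meaningful for vertices \<open>v \<noteq> r\<close>.\<close>
definition parent :: "'a pair_pre_digraph \<Rightarrow> 'a \<Rightarrow> 'a \<Rightarrow> 'a" where
  "parent T r v = last (butlast (tree_path T r v))"

definition children :: "'a pair_pre_digraph \<Rightarrow> 'a \<Rightarrow> 'a \<Rightarrow> 'a set" where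
  "children T r v = {w \<in> pverts T. w \<noteq> r \<and> parent T r w = v}"

text \<open>In a \<open>rooted_tree\<close> all the sets of children are finite, so \<open>card\<close> is the true cardinality.\<close>
definition homogeneous :: "'a pair_pre_digraph \<Rightarrow> 'a \<Rightarrow> nat \<Rightarrow> bool" where
  "homogeneous T r \<gamma> \<longleftrightarrow> (\<forall>v \<in> pverts T. card (children T r v) = \<gamma>)"

definition tree_deriv :: "'a pair_pre_digraph \<Rightarrow> 'a \<Rightarrow> ('a \<Rightarrow> complex) \<Rightarrow> 'a \<Rightarrow> complex" where
  "tree_deriv T r f v = (if v = r then f v else f v - f (parent T r v))"

text \<open>
  A function on the vertex set is represented by a function on the whole type that vanishes off
  the vertex set. The filter expresses that \<open>v\<close> runs through the vertices with
  \<open>depth T r v \<rightarrow> \<infinity>\<close>.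
\<close>
definition little_lipschitz :: "'a pair_pre_digraph \<Rightarrow> 'a \<Rightarrow> ('a \<Rightarrow> complex) set" where
  "little_lipschitz T r =
     {f. (\<forall>v. v \<notin> pverts T \<longrightarrow> f v = 0) \<and>
         (tree_deriv T r f \<longlongrightarrow> 0) (inf (filtercomap (depth T r) at_top) (principal (pverts T)))}"

text \<open>
  The real supremum is the intended one on \<open>little_lipschitz T r\<close>: since degrees are finite, only
  finitely many vertices have bounded depth, so the derivative of a member is bounded.
\<close>
definition lipschitz_norm :: "'a pair_pre_digraph \<Rightarrow> 'a \<Rightarrow> ('a \<Rightarrow> complex) \<Rightarrow> real" where
  "lipschitz_norm T r f = (SUP v \<in> pverts T. cmod (tree_deriv T r f v))"

definition backward_shift ::
  "'a pair_pre_digraph \<Rightarrow> 'a \<Rightarrow> ('a \<Rightarrow> complex) \<Rightarrow> 'a \<Rightarrow> complex" where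
  "backward_shift T r f v = (\<Sum>w \<in> children T r v. f w)"

definition bounded_operator ::
  "'a pair_pre_digraph \<Rightarrow> 'a \<Rightarrow> (('a \<Rightarrow> complex) \<Rightarrow> 'a \<Rightarrow> complex) \<Rightarrow> bool" where
  "bounded_operator T r A \<longleftrightarrow>
     A \<in> little_lipschitz T r \<rightarrow> little_lipschitz T r \<and>
     (\<forall>f \<in> little_lipschitz T r. \<forall>g \<in> little_lipschitz T r.
        A (\<lambda>v. f v + g v) = (\<lambda>v. A f v + A g v)) \<and>
     (\<forall>c. \<forall>f \<in> little_lipschitz T r. A (\<lambda>v. c * f v) = (\<lambda>v. c * A f v)) \<and>
     (\<exists>C. \<forall>f \<in> little_lipschitz T r. lipschitz_norm T r (A f) \<le> C * lipschitz_norm T r f)"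

text \<open>Only meaningful if \<open>bounded_operator T r A\<close> holds, as otherwise the supremum may be infinite.\<close>
definition operator_norm ::
  "'a pair_pre_digraph \<Rightarrow> 'a \<Rightarrow> (('a \<Rightarrow> complex) \<Rightarrow> 'a \<Rightarrow> complex) \<Rightarrow> real" where
  "operator_norm T r A =
     (SUP f \<in> {f \<in> little_lipschitz T r. lipschitz_norm T r f \<le> 1}. lipschitz_norm T r (A f))"

end

theory Submission
  imports Defs
begin

text \<open>
  Write \<open>\<delta> f\<close> for the derivative \<open>f'\<close>, so that the norm of \<open>f\<close> is the supremum of \<open>\<bar>\<delta> f\<bar>\<close>. Everything
  rests on expressing \<open>\<delta> (B f)\<close> by values of \<open>\<delta> f\<close>. At the root, each child \<open>w\<close> contributes
  \<open>f w = \<delta> f root + \<delta> f w\<close>, so \<open>\<delta> (B f) root\<close> is a combination of values of \<open>\<delta> f\<close> with \<open>2 \<gamma>\<close> as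
  the sum of the moduli of its coefficients. At a vertex \<open>v\<close> other than the root,
  \<open>\<delta> (B f) v\<close> compares the sum of \<open>f\<close> over the children of \<open>v\<close> with its sum over \<open>v\<close> and the siblings
  of \<open>v\<close>. Both sums have \<open>\<gamma>\<close> terms, so measuring all of them from the common ancestor \<open>par v\<close> makes
  the value \<open>f (par v)\<close> cancel, and what remains is
    \<open>(\<gamma> - 1) \<delta> f v\<close> plus the \<open>\<delta> f w\<close> of the children \<open>w\<close> of \<open>v\<close>
    minus the \<open>\<delta> f u\<close> of the siblings \<open>u\<close> of \<open>v\<close>
  (lemma \<open>deriv_backward_shift_nonroot\<close>). Here the coefficients add up to
  \<open>(\<gamma> - 1) + \<gamma> + (\<gamma> - 1) = 3 \<gamma> - 2\<close> in modulus. These vertices are all at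
  least as deep as \<open>v\<close>, so the same formula shows that \<open>\<delta> (B f)\<close> tends to zero along with \<open>\<delta> f\<close>.

  Both bounds are attained. A function on the tree is determined by its derivative, which may be
  prescribed freely: \<open>f v\<close> is the sum of the derivative over the path from the root to \<open>v\<close>
  (lemma \<open>deriv_primitive\<close>). A finitely supported derivative with values in \<open>{-1, 0, 1}\<close>, chosen to
  match the signs of the coefficients at the root or at a child of the root, yields an \<open>f\<close> of norm at
  most 1 whose image has norm at least \<open>2 \<gamma>\<close> or \<open>3 \<gamma> - 2\<close>. So the operator norm is the
  maximum of these numbers (lemma \<open>operator_norm_backward_shift\<close>), which is the first one for
  \<open>\<gamma> = 1\<close> and the second one for \<open>\<gamma> \<ge> 2\<close>.
\<close>

section \<open>Parents, children and depth\<close>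

context rooted_tree
begin

abbreviation par :: "'a \<Rightarrow> 'a" where "par \<equiv> parent T root"
abbreviation chi :: "'a \<Rightarrow> 'a set" where "chi \<equiv> children T root"
abbreviation dep :: "'a \<Rightarrow> nat" where "dep \<equiv> depth T root"
abbreviation \<delta> :: "('a \<Rightarrow> complex) \<Rightarrow> 'a \<Rightarrow> complex" where "\<delta> \<equiv> tree_deriv T root"
abbreviation B :: "('a \<Rightarrow> complex) \<Rightarrow> 'a \<Rightarrow> complex" where "B \<equiv> backward_shift T root"
abbreviation \<L>0 :: "('a \<Rightarrow> complex) set" where "\<L>0 \<equiv> little_lipschitz T root"
abbreviation nrm :: "('a \<Rightarrow> complex) \<Rightarrow> real" where "nrm \<equiv> lipschitz_norm T root"

lemma tree_path_eqI:
  assumes "path_between T u v p"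
  shows "tree_path T u v = p"
proof -
  have "p \<noteq> []" "set p \<subseteq> pverts T" "hd p = u" "last p = v"
    using assms by (auto simp: path_between_def vpath_def vwalk_def)
  then have "u \<in> pverts T" "v \<in> pverts T"
    using hd_in_set last_in_set by blast+
  then show ?thesis
    unfolding tree_path_def using unique_path assms by (blast intro: the1_equality)
qed

lemma path_between_tree_path:
  assumes "u \<in> pverts T" "v \<in> pverts T"
  shows "path_between T u v (tree_path T u v)"
  unfolding tree_path_def using unique_path[OF assms] by (rule theI')

lemma tree_path_root: "tree_path T root root = [root]"
  by (rule tree_path_eqI) (auto simp: path_between_def vpath_def vwalk_def root_in_verts)

lemma tree_path_parent:
  assumes "v \<in> pverts T" "v \<noteq> root"
  shows "tree_path T root v = tree_path T root (par v) @ [v]"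
    and "par v \<in> pverts T"
    and "(par v, v) \<in> parcs T"
proof -
  define p where "p = tree_path T root v"
  define q where "q = butlast p"
  have p: "path_between T root v p"
    unfolding p_def using path_between_tree_path root_in_verts assms(1) by blast
  then have ne: "p \<noteq> []" and hd: "hd p = root" and last: "last p = v"
    by (auto simp: path_between_def vpath_def vwalk_def)
  have pq: "p = q @ [v]"
    unfolding q_def using ne last by (metis append_butlast_last_id)
  have qne: "q \<noteq> []"
    using pq hd assms(2) by auto
  have par: "par v = last q"
    by (simp add: parent_def q_def p_def)
  have verts: "set q \<subseteq> pverts T" and arcs: "set (vwalk_arcs q) \<subseteq> parcs T"
    and arc: "(last q, v) \<in> parcs T" and "distinct q"
    using p qne
    by (auto simp: path_between_def vpath_def vwalk_def pq vwalk_arcs_append)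
  then have "path_between T root (last q) q"
    using hd qne by (auto simp: path_between_def vpath_def vwalk_def pq)
  then show "tree_path T root v = tree_path T root (par v) @ [v]"
    using tree_path_eqI par pq p_def by metis
  show "par v \<in> pverts T"
    using par verts qne last_in_set by fastforce
  show "(par v, v) \<in> parcs T"
    using par arc by simp
qed

lemma depth_parent:
  assumes "v \<in> pverts T" "v \<noteq> root"
  shows "dep v = Suc (dep (par v))"
proof -
  have "tree_path T root (par v) \<noteq> []"
    using path_between_tree_path[OF root_in_verts tree_path_parent(2)[OF assms]]
    by (auto simp: path_between_def vpath_def vwalk_def)
  then show ?thesis
    by (cases "tree_path T root (par v)") (simp_all add: depth_def tree_path_parent(1)[OF assms])
qed

lemma depth_root: "dep root = 0"
  by (simp add: depth_def tree_path_root)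

lemma mem_childrenD:
  assumes "w \<in> chi v"
  shows "w \<in> pverts T" "w \<noteq> root" "par w = v" "v \<in> pverts T" "dep w = Suc (dep v)"
  using assms tree_path_parent(2)[of w] depth_parent[of w] by (auto simp: children_def)

lemma mem_children_parent: "v \<in> pverts T \<Longrightarrow> v \<noteq> root \<Longrightarrow> v \<in> chi (par v)"
  by (simp add: children_def)

lemma finite_children: "finite (chi v)"
proof (cases "v \<in> pverts T")
  case True
  have "chi v \<subseteq> {w. (v, w) \<in> parcs T}"
    using tree_path_parent(3) by (auto simp: children_def)
  then show ?thesis
    using finite_degree[OF True] finite_subset by blast
next
  case False
  then have "chi v = {}" using mem_childrenD(4) by blast
  then show ?thesis by simp
qed

lemma finite_bounded_depth: "finite {v \<in> pverts T. dep v \<le> n}"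
proof (induction n)
  case 0
  have "{v \<in> pverts T. dep v \<le> 0} \<subseteq> {root}"
    using depth_parent by fastforce
  then show ?case by (rule finite_subset) simp
next
  case (Suc n)
  have "{v \<in> pverts T. dep v \<le> Suc n}
      \<subseteq> insert root (\<Union>u \<in> {v \<in> pverts T. dep v \<le> n}. chi u)"
    using depth_parent mem_children_parent tree_path_parent(2) by fastforce
  then show ?case
    by (rule finite_subset) (use Suc finite_children in auto)
qed

section \<open>The little Lipschitz space\<close>

lemma little_lipschitz_iff:
  "f \<in> \<L>0 \<longleftrightarrow>
     (\<forall>v. v \<notin> pverts T \<longrightarrow> f v = 0) \<and>
     (\<forall>e>0. \<exists>N. \<forall>v\<in>pverts T. N \<le> dep v \<longrightarrow> cmod (\<delta> f v) < e)"
proof -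
  have "(\<forall>\<^sub>F v in inf (filtercomap dep at_top) (principal (pverts T)). dist (\<delta> f v) 0 < e) \<longleftrightarrow>
        (\<exists>N. \<forall>v\<in>pverts T. N \<le> dep v \<longrightarrow> cmod (\<delta> f v) < e)" for e
    unfolding eventually_inf_principal eventually_filtercomap eventually_at_top_linorder
    by (auto 0 4)
  then show ?thesis
    by (simp add: little_lipschitz_def tendsto_iff)
qed

lemma bdd_above_deriv:
  assumes "f \<in> \<L>0"
  shows "bdd_above ((\<lambda>v. cmod (\<delta> f v)) ` pverts T)"
proof -
  obtain N where N: "\<And>v. v \<in> pverts T \<Longrightarrow> N \<le> dep v \<Longrightarrow> cmod (\<delta> f v) < 1"
    using assms unfolding little_lipschitz_iff by (meson zero_less_one)
  let ?A = "(\<lambda>v. cmod (\<delta> f v)) ` {v \<in> pverts T. dep v \<le> N}"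
  have "bdd_above ({..1} \<union> ?A)"
    using finite_bounded_depth[of N] by simp
  moreover have "(\<lambda>v. cmod (\<delta> f v)) ` pverts T \<subseteq> {..1} \<union> ?A"
    using N by (force simp: not_le)
  ultimately show ?thesis
    by (rule bdd_above_mono)
qed

lemma norm_deriv_le_lipschitz_norm:
  "f \<in> \<L>0 \<Longrightarrow> v \<in> pverts T \<Longrightarrow> cmod (\<delta> f v) \<le> nrm f"
  unfolding lipschitz_norm_def by (intro cSUP_upper bdd_above_deriv)

lemma lipschitz_norm_leI:
  "(\<And>v. v \<in> pverts T \<Longrightarrow> cmod (\<delta> f v) \<le> C) \<Longrightarrow> nrm f \<le> C"
  unfolding lipschitz_norm_def using root_in_verts by (intro cSUP_least) auto

definition primitive :: "('a \<Rightarrow> complex) \<Rightarrow> 'a \<Rightarrow> complex" where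
  "primitive g v = (if v \<in> pverts T then sum_list (map g (tree_path T root v)) else 0)"

lemma deriv_primitive:
  assumes "v \<in> pverts T"
  shows "\<delta> (primitive g) v = g v"
proof (cases "v = root")
  case True
  then show ?thesis
    using assms by (simp add: tree_deriv_def primitive_def tree_path_root)
next
  case False
  then show ?thesis
    using assms tree_path_parent[OF assms False]
    by (simp add: tree_deriv_def primitive_def)
qed

lemma primitive_in_little_lipschitz:
  assumes "finite {v \<in> pverts T. g v \<noteq> 0}"
  shows "primitive g \<in> \<L>0"
proof -
  obtain N where N: "\<And>v. v \<in> pverts T \<Longrightarrow> g v \<noteq> 0 \<Longrightarrow> dep v < N"
    using finite_nat_set_iff_bounded[of "dep ` {v \<in> pverts T. g v \<noteq> 0}"] assms by auto
  then have "\<forall>v\<in>pverts T. N \<le> dep v \<longrightarrow> cmod (\<delta> (primitive g) v) < e" if "e > 0" for e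
    using that by (metis deriv_primitive norm_zero not_le)
  then show ?thesis
    unfolding little_lipschitz_iff primitive_def by auto
qed

end

section \<open>The derivative of the backward shift\<close>

locale homogeneous_tree = rooted_tree T root for T :: "'a pair_pre_digraph" and root +
  fixes \<gamma> :: nat
  assumes homogeneous: "homogeneous T root \<gamma>"
begin

lemma card_children: "v \<in> pverts T \<Longrightarrow> card (chi v) = \<gamma>"
  using homogeneous by (simp add: homogeneous_def)

lemma order_pos_if_nonroot:
  assumes "v \<in> pverts T" "v \<noteq> root"
  shows "\<gamma> \<ge> 1"
proof -
  have "card (chi (par v)) > 0"
    using mem_children_parent[OF assms] finite_children by (auto simp: card_gt_0_iff)
  then show ?thesis
    using card_children[OF tree_path_parent(2)[OF assms]] by simp
qed

lemma backward_shift_eq: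
  assumes "v \<in> pverts T"
  shows "B f v = of_nat \<gamma> * f v + (\<Sum>w\<in>chi v. \<delta> f w)"
proof -
  have "B f v = (\<Sum>w\<in>chi v. f v + \<delta> f w)"
    unfolding backward_shift_def
    by (rule sum.cong) (auto simp: tree_deriv_def dest: mem_childrenD)
  then show ?thesis
    by (simp add: sum.distrib card_children assms)
qed

lemma deriv_backward_shift_root:
  "\<delta> (B f) root = of_nat \<gamma> * \<delta> f root + (\<Sum>w\<in>chi root. \<delta> f w)"
  using backward_shift_eq[OF root_in_verts] by (simp add: tree_deriv_def)

text \<open>
  Since \<open>v\<close> and its parent have equally many children, the value of \<open>f\<close> at the parent cancels. The
  vertex \<open>v\<close> is itself a child of its parent, which leaves the coefficient \<open>\<gamma> - 1\<close> for \<open>\<delta> f v\<close>; without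
  this last cancellation the estimate below would only give \<open>3 \<gamma>\<close>.
\<close>
lemma deriv_backward_shift_nonroot:
  assumes "v \<in> pverts T" "v \<noteq> root"
  shows "\<delta> (B f) v =
    (of_nat \<gamma> - 1) * \<delta> f v + (\<Sum>w\<in>chi v. \<delta> f w) - (\<Sum>u\<in>chi (par v) - {v}. \<delta> f u)"
proof -
  have "(\<Sum>u\<in>chi (par v). \<delta> f u) = \<delta> f v + (\<Sum>u\<in>chi (par v) - {v}. \<delta> f u)"
    using mem_children_parent[OF assms] finite_children by (simp add: sum.remove)
  moreover have "f v = f (par v) + \<delta> f v"
    using assms(2) by (simp add: tree_deriv_def)
  moreover have "\<delta> (B f) v = B f v - B f (par v)"
    using assms(2) by (simp add: tree_deriv_def)
  ultimately show ?thesis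
    by (simp add: backward_shift_eq assms tree_path_parent(2) algebra_simps)
qed

lemma norm_sum_children_le:
  assumes "v \<in> pverts T" and "\<And>w. w \<in> chi v \<Longrightarrow> cmod (g w) \<le> e"
  shows "cmod (\<Sum>w\<in>chi v. g w) \<le> real \<gamma> * e"
  using sum_norm_bound[of "chi v" g e] assms by (simp add: card_children)

lemma norm_deriv_backward_shift_nonroot_le:
  assumes v: "v \<in> pverts T" "v \<noteq> root"
    and e: "cmod (\<delta> f v) \<le> e" "\<And>w. w \<in> chi v \<Longrightarrow> cmod (\<delta> f w) \<le> e"
      "\<And>u. u \<in> chi (par v) \<Longrightarrow> cmod (\<delta> f u) \<le> e"
  shows "cmod (\<delta> (B f) v) \<le> (3 * real \<gamma> - 2) * e"
proof -
  have \<gamma>: "\<gamma> \<ge> 1"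
    using order_pos_if_nonroot v .
  have "card (chi (par v) - {v}) = \<gamma> - 1"
    using mem_children_parent[OF v] finite_children card_children tree_path_parent(2)[OF v]
    by simp
  then have siblings: "cmod (\<Sum>u\<in>chi (par v) - {v}. \<delta> f u) \<le> (real \<gamma> - 1) * e"
    using sum_norm_bound[of "chi (par v) - {v}" "\<delta> f" e] e(3) \<gamma> by (simp add: of_nat_diff)
  have "cmod (of_nat \<gamma> - 1) = real \<gamma> - 1"
    using \<gamma> norm_of_nat[of "\<gamma> - 1", where 'a = complex] by (simp add: of_nat_diff)
  then have "cmod ((of_nat \<gamma> - 1) * \<delta> f v) = (real \<gamma> - 1) * cmod (\<delta> f v)"
    by (simp only: norm_mult)
  also have "\<dots> \<le> (real \<gamma> - 1) * e"
    using e(1) \<gamma> by (intro mult_left_mono) auto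
  finally have self: "cmod ((of_nat \<gamma> - 1) * \<delta> f v) \<le> (real \<gamma> - 1) * e" .
  have children: "cmod (\<Sum>w\<in>chi v. \<delta> f w) \<le> real \<gamma> * e"
    by (rule norm_sum_children_le) (use v e in auto)
  have "cmod (\<delta> (B f) v) \<le> (real \<gamma> - 1) * e + real \<gamma> * e + (real \<gamma> - 1) * e"
    unfolding deriv_backward_shift_nonroot[OF v]
    by (intro norm_triangle_le_diff norm_triangle_le add_mono self children siblings)
  then show ?thesis
    by (simp add: algebra_simps)
qed

lemma norm_deriv_backward_shift_root_le:
  assumes "\<And>v. v \<in> pverts T \<Longrightarrow> cmod (\<delta> f v) \<le> e"
  shows "cmod (\<delta> (B f) root) \<le> 2 * real \<gamma> * e"
proof -
  have "cmod (of_nat \<gamma> * \<delta> f root) \<le> real \<gamma> * e"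
    using assms[OF root_in_verts] by (simp add: norm_mult mult_left_mono)
  moreover have "cmod (\<Sum>w\<in>chi root. \<delta> f w) \<le> real \<gamma> * e"
    by (rule norm_sum_children_le) (use assms root_in_verts mem_childrenD(1) in auto)
  ultimately have "cmod (\<delta> (B f) root) \<le> real \<gamma> * e + real \<gamma> * e"
    unfolding deriv_backward_shift_root by (intro norm_triangle_le add_mono)
  then show ?thesis
    by (simp add: algebra_simps)
qed

section \<open>The backward shift as a bounded operator\<close>

lemma backward_shift_in_little_lipschitz:
  assumes f: "f \<in> \<L>0"
  shows "B f \<in> \<L>0"
  unfolding little_lipschitz_iff
proof (intro conjI allI impI)
  fix v
  assume "v \<notin> pverts T"
  then have "chi v = {}"
    using mem_childrenD(4) by blast
  then show "B f v = 0"
    by (simp add: backward_shift_def)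
next
  fix e :: real
  assume e: "e > 0"
  define d where "d = e / (3 * real \<gamma> + 1)"
  have d: "d > 0"
    using e by (simp add: d_def)
  have de: "(3 * real \<gamma> - 2) * d < e"
    using e by (simp add: d_def divide_less_eq algebra_simps)
  obtain N where N: "\<And>v. v \<in> pverts T \<Longrightarrow> N \<le> dep v \<Longrightarrow> cmod (\<delta> f v) < d"
    using f d unfolding little_lipschitz_iff by meson
  show "\<exists>N. \<forall>v\<in>pverts T. N \<le> dep v \<longrightarrow> cmod (\<delta> (B f) v) < e"
  proof (intro exI ballI impI)
    fix v
    \<comment> \<open>Depth at least 1 excludes the root, which has no siblings to cancel \<open>f\<close> against.\<close>
    assume v: "v \<in> pverts T" and deep: "Suc N \<le> dep v"
    then have "v \<noteq> root"
      using depth_root by auto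
    moreover from this have "dep u = dep v" if "u \<in> chi (par v)" for u
      using that v depth_parent mem_childrenD(5) by simp
    ultimately have "cmod (\<delta> (B f) v) \<le> (3 * real \<gamma> - 2) * d"
      using v deep
      by (intro norm_deriv_backward_shift_nonroot_le less_imp_le[OF N]) (auto dest: mem_childrenD)
    with de show "cmod (\<delta> (B f) v) < e"
      by simp
  qed
qed

lemma lipschitz_norm_backward_shift_le:
  assumes f: "f \<in> \<L>0"
  shows "nrm (B f) \<le> max (2 * real \<gamma>) (3 * real \<gamma> - 2) * nrm f"
proof (rule lipschitz_norm_leI)
  fix v
  assume v: "v \<in> pverts T"
  note le = norm_deriv_le_lipschitz_norm[OF f]
  have nonneg: "nrm f \<ge> 0"
    using le[OF root_in_verts] norm_ge_zero order_trans by blast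
  show "cmod (\<delta> (B f) v) \<le> max (2 * real \<gamma>) (3 * real \<gamma> - 2) * nrm f"
  proof (cases "v = root")
    case True
    have "cmod (\<delta> (B f) root) \<le> 2 * real \<gamma> * nrm f"
      by (rule norm_deriv_backward_shift_root_le[OF le])
    also have "\<dots> \<le> max (2 * real \<gamma>) (3 * real \<gamma> - 2) * nrm f"
      using nonneg by (intro mult_right_mono) auto
    finally show ?thesis using True by simp
  next
    case False
    have "cmod (\<delta> (B f) v) \<le> (3 * real \<gamma> - 2) * nrm f"
      by (rule norm_deriv_backward_shift_nonroot_le) (use v False le mem_childrenD(1) in auto)
    also have "\<dots> \<le> max (2 * real \<gamma>) (3 * real \<gamma> - 2) * nrm f"
      using nonneg by (intro mult_right_mono) auto
    finally show ?thesis .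
  qed
qed

lemma bounded_operator_backward_shift: "bounded_operator T root B"
  unfolding bounded_operator_def
proof (intro conjI ballI allI)
  show "B \<in> \<L>0 \<rightarrow> \<L>0"
    using backward_shift_in_little_lipschitz by blast
  show "\<exists>C. \<forall>f\<in>\<L>0. nrm (B f) \<le> C * nrm f"
    using lipschitz_norm_backward_shift_le by blast
qed (auto simp: backward_shift_def sum.distrib sum_distrib_left)

section \<open>The operator norm\<close>

lemma lipschitz_norm_backward_shift_unit_le:
  assumes "f \<in> \<L>0" "nrm f \<le> 1"
  shows "nrm (B f) \<le> max (2 * real \<gamma>) (3 * real \<gamma> - 2)"
proof -
  have "nrm (B f) \<le> max (2 * real \<gamma>) (3 * real \<gamma> - 2) * nrm f"
    by (rule lipschitz_norm_backward_shift_le) fact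
  also have "\<dots> \<le> max (2 * real \<gamma>) (3 * real \<gamma> - 2) * 1"
    using assms(2) by (intro mult_left_mono) (auto simp: le_max_iff_disj)
  finally show ?thesis by simp
qed

text \<open>
  Every finitely supported \<open>g\<close> with values in the unit disc is the derivative of a competitor for the
  supremum that defines the operator norm.
\<close>
lemma norm_deriv_backward_shift_primitive_le_operator_norm:
  assumes "finite {v \<in> pverts T. g v \<noteq> 0}" and "\<And>v. cmod (g v) \<le> 1" and "v \<in> pverts T"
  shows "cmod (\<delta> (B (primitive g)) v) \<le> operator_norm T root B"
proof -
  have mem: "primitive g \<in> \<L>0"
    using assms(1) by (rule primitive_in_little_lipschitz)
  have unit: "nrm (primitive g) \<le> 1"
    by (rule lipschitz_norm_leI) (simp add: deriv_primitive assms(2))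
  have "cmod (\<delta> (B (primitive g)) v) \<le> nrm (B (primitive g))"
    using norm_deriv_le_lipschitz_norm backward_shift_in_little_lipschitz mem assms(3) by blast
  also have "\<dots> \<le> operator_norm T root B"
    unfolding operator_norm_def
    by (rule cSUP_upper)
      (use mem unit lipschitz_norm_backward_shift_unit_le in \<open>auto intro!: bdd_aboveI2\<close>)
  finally show ?thesis .
qed

lemma operator_norm_ge_root: "2 * real \<gamma> \<le> operator_norm T root B"
proof -
  define g :: "'a \<Rightarrow> complex" where "g = indicator (insert root (chi root))"
  have "(\<Sum>w\<in>chi root. \<delta> (primitive g) w) = (\<Sum>w\<in>chi root. 1)"
    by (rule sum.cong) (simp_all add: g_def deriv_primitive mem_childrenD(1))
  then have "\<delta> (B (primitive g)) root = of_nat (2 * \<gamma>)"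
    using root_in_verts
    by (simp add: deriv_backward_shift_root deriv_primitive card_children g_def)
  moreover have "cmod (\<delta> (B (primitive g)) root) \<le> operator_norm T root B"
  proof (rule norm_deriv_backward_shift_primitive_le_operator_norm)
    show "finite {v \<in> pverts T. g v \<noteq> 0}"
      by (rule finite_subset[of _ "insert root (chi root)"])
        (auto simp: g_def indicator_def finite_children)
  qed (auto simp: g_def indicator_def root_in_verts)
  ultimately have "cmod (of_nat (2 * \<gamma>)) \<le> operator_norm T root B"
    by (simp only:)
  then show ?thesis
    unfolding norm_of_nat by simp
qed

text \<open>
  The test function is steered by the formula for \<open>\<delta> (B f) v\<close> at a child \<open>v\<close> of the root: derivative
  \<open>1\<close> at \<open>v\<close> and its children, \<open>-1\<close> at its siblings.
\<close>
lemma operator_norm_ge_nonroot: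
  assumes "\<gamma> \<ge> 1"
  shows "3 * real \<gamma> - 2 \<le> operator_norm T root B"
proof -
  obtain v where v: "v \<in> chi root"
    using assms card_children[OF root_in_verts] by (metis card.empty ex_in_conv not_one_le_zero)
  note vD = mem_childrenD[OF v]
  define g :: "'a \<Rightarrow> complex" where
    "g = (\<lambda>x. indicator (insert v (chi v)) x - indicator (chi root - {v}) x)"
  have disjoint: "x \<notin> chi root" if "x \<in> chi v" for x
    using that mem_childrenD(5)[of x v] mem_childrenD(5)[of x root] vD(5) by auto
  have "v \<notin> chi v"
    using disjoint v by blast
  then have self: "\<delta> (primitive g) v = 1"
    using vD(1) by (simp add: deriv_primitive g_def)
  have children: "(\<Sum>w\<in>chi v. \<delta> (primitive g) w) = (\<Sum>w\<in>chi v. 1)"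
    using disjoint
    by (intro sum.cong) (simp_all add: g_def deriv_primitive mem_childrenD(1))
  have siblings: "(\<Sum>u\<in>chi root - {v}. \<delta> (primitive g) u) = (\<Sum>u\<in>chi root - {v}. - 1)"
    using disjoint
    by (intro sum.cong) (auto simp: g_def deriv_primitive mem_childrenD(1) indicator_def)
  have "card (chi root - {v}) = \<gamma> - 1"
    using v by (simp add: finite_children card_children root_in_verts)
  then have "\<delta> (B (primitive g)) v = of_real (3 * real \<gamma> - 2)"
    using vD assms
    by (simp add: deriv_backward_shift_nonroot self children siblings card_children of_nat_diff)
  moreover have "cmod (\<delta> (B (primitive g)) v) \<le> operator_norm T root B"
  proof (rule norm_deriv_backward_shift_primitive_le_operator_norm)
    show "finite {x \<in> pverts T. g x \<noteq> 0}"
      by (rule finite_subset[of _ "insert v (chi v) \<union> chi root"])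
        (auto simp: g_def indicator_def finite_children)
    show "cmod (g x) \<le> 1" for x
      by (auto simp: g_def indicator_def)
  qed (rule vD(1))
  ultimately have "cmod (of_real (3 * real \<gamma> - 2)) \<le> operator_norm T root B"
    by (simp only:)
  then show ?thesis
    unfolding norm_of_real by linarith
qed

lemma operator_norm_backward_shift:
  assumes "\<gamma> \<ge> 1"
  shows "operator_norm T root B = max (2 * real \<gamma>) (3 * real \<gamma> - 2)"
proof (rule antisym)
  have "primitive (\<lambda>_. 0) \<in> \<L>0" "nrm (primitive (\<lambda>_. 0)) \<le> 1"
    by (auto intro: primitive_in_little_lipschitz lipschitz_norm_leI simp: deriv_primitive)
  then have "{f \<in> \<L>0. nrm f \<le> 1} \<noteq> {}"
    by blast
  then show "operator_norm T root B \<le> max (2 * real \<gamma>) (3 * real \<gamma> - 2)"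
    unfolding operator_norm_def
    by (rule cSUP_least) (use lipschitz_norm_backward_shift_unit_le in auto)
  show "max (2 * real \<gamma>) (3 * real \<gamma> - 2) \<le> operator_norm T root B"
    using operator_norm_ge_root operator_norm_ge_nonroot[OF assms] by simp
qed

end

theorem theorem5p2:
  fixes T :: "'a pair_pre_digraph" and root :: 'a and \<gamma> :: nat
  assumes "rooted_tree T root"
    and "homogeneous T root \<gamma>"
  shows "bounded_operator T root (backward_shift T root) \<and>
         (\<gamma> = 1 \<longrightarrow> operator_norm T root (backward_shift T root) = 2) \<and>
         (\<gamma> \<ge> 2 \<longrightarrow> operator_norm T root (backward_shift T root) = 3 * real \<gamma> - 2)"
proof -
  interpret homogeneous_tree T root \<gamma>
    using assms by (intro homogeneous_tree.intro homogeneous_tree_axioms.intro)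
  show ?thesis
    using bounded_operator_backward_shift operator_norm_backward_shift by simp
qed

end
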